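(* Let $(X,p)$ be a partial metric space, let $r\ge 0$, and let $\{x_n\}$ be a sequence in $X$ that is $r$-convergent from right. Then $R\text{-}LIM^{r}x_n$ is a closed set in $(X,p)$ (with respect to the topology $\tau(p)$).
   Context: A partial metric on a nonempty set $X$ is a function $p:X\times X\to[0,\infty)$ such that for all $x,y,z\in X$: (p1) $0\le p(x,x)\le p(x,y)$; (p2) $x=y \iff p(x,x)=p(x,y)=p(y,y)$; (p3) $p(x,y)=p(y,x)$; (p4) $p(x,y)\le p(x,z)+p(z,y)-p(z,z)$. The pair $(X,p)$ is a partial metric space. For $r>0$ and $x\in X$, the open ball is $B^{p}_{r}(x)=\{y\in X: p(x,y)<p(x,x)+r\}$. A subset $U\subseteq X$ is open if for every $x\in U$ there is $r>0$ with $B^{p}_{r}(x)\subset U$; this topology is denoted $\tau(p)$, and the open balls form a basis for it. For $r\ge 0$, a sequence $\{x_n\}$ is $r$-convergent to $x\in X$ from right if for every $\epsilon>0$ there is $k\in\mathbb{N}$ such that $|p(x_n,x)-p(x,x)|<r+\epsilon$ for all $n\ge k$ with $p(x_n,x)\ge p(x,x)$. It is $r$-convergent from right if this holds for some $x\in X$. $R\text{-}LIM^{r}x_n$ denotes the set of all $x\in X$ such that $\{x_n\}$ is $r$-convergent to $x$ from right. *)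

theory Defs
  imports "HOL-Analysis.Abstract_Topology"
begin

locale partial_metric_space =
  fixes X :: "'a set" and p :: "'a \<Rightarrow> 'a \<Rightarrow> real"
  assumes nonempty: "X \<noteq> {}"
    and p1: "\<And>x y. x \<in> X \<Longrightarrow> y \<in> X \<Longrightarrow> 0 \<le> p x x \<and> p x x \<le> p x y"
    and p2: "\<And>x y. x \<in> X \<Longrightarrow> y \<in> X \<Longrightarrow> x = y \<longleftrightarrow> p x x = p x y \<and> p x y = p y y"
    and p3: "\<And>x y. x \<in> X \<Longrightarrow> y \<in> X \<Longrightarrow> p x y = p y x"
    and p4: "\<And>x y z. x \<in> X \<Longrightarrow> y \<in> X \<Longrightarrow> z \<in> X \<Longrightarrow> p x y \<le> p x z + p z y - p z z"

definition pball :: "'a set \<Rightarrow> ('a \<Rightarrow> 'a \<Rightarrow> real) \<Rightarrow> 'a \<Rightarrow> real \<Rightarrow> 'a set" where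
  "pball X p x r = {y \<in> X. p x y < p x x + r}"

definition ptopology :: "'a set \<Rightarrow> ('a \<Rightarrow> 'a \<Rightarrow> real) \<Rightarrow> 'a topology" where
  "ptopology X p = topology (\<lambda>U. U \<subseteq> X \<and> (\<forall>x\<in>U. \<exists>r>0. pball X p x r \<subseteq> U))"

lemma istopology_ptopology:
  "istopology (\<lambda>U. U \<subseteq> X \<and> (\<forall>x\<in>U. \<exists>r>0. pball X p x r \<subseteq> U))"
  unfolding istopology_def
proof (rule conjI; intro allI impI)
  fix S T
  assume S: "S \<subseteq> X \<and> (\<forall>x\<in>S. \<exists>r>0. pball X p x r \<subseteq> S)"
    and T: "T \<subseteq> X \<and> (\<forall>x\<in>T. \<exists>r>0. pball X p x r \<subseteq> T)"
  have "\<exists>r>0. pball X p x r \<subseteq> S \<inter> T" if "x \<in> S \<inter> T" for x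
  proof -
    obtain a b where "a > 0" "pball X p x a \<subseteq> S" "b > 0" "pball X p x b \<subseteq> T"
      using S T \<open>x \<in> S \<inter> T\<close> by (meson IntE)
    moreover have "pball X p x (min a b) \<subseteq> pball X p x a \<inter> pball X p x b"
      by (auto simp: pball_def)
    ultimately show ?thesis
      by (intro exI[of _ "min a b"]) auto
  qed
  moreover have "S \<inter> T \<subseteq> X"
    using S by (simp add: le_infI1)
  ultimately show "S \<inter> T \<subseteq> X \<and> (\<forall>x\<in>S \<inter> T. \<exists>r>0. pball X p x r \<subseteq> S \<inter> T)"
    by (intro conjI ballI)
next
  fix K
  assume K: "\<forall>S\<in>K. S \<subseteq> X \<and> (\<forall>x\<in>S. \<exists>r>0. pball X p x r \<subseteq> S)"
  show "\<Union>K \<subseteq> X \<and> (\<forall>x\<in>\<Union>K. \<exists>r>0. pball X p x r \<subseteq> \<Union>K)"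
  proof (intro conjI ballI)
    show "\<Union>K \<subseteq> X" using K by blast
  next
    fix x assume "x \<in> \<Union>K"
    then obtain S where "S \<in> K" "x \<in> S" by blast
    with K obtain r where r: "r > 0" "pball X p x r \<subseteq> S" by meson
    have "pball X p x r \<subseteq> \<Union>K"
      using r(2) Union_upper[OF \<open>S \<in> K\<close>] by (rule subset_trans)
    with r(1) show "\<exists>r>0. pball X p x r \<subseteq> \<Union>K" by (intro exI[of _ r] conjI)
  qed
qed

lemma openin_ptopology:
  "openin (ptopology X p) U \<longleftrightarrow> U \<subseteq> X \<and> (\<forall>x\<in>U. \<exists>r>0. pball X p x r \<subseteq> U)"
  by (simp add: ptopology_def topology_inverse'[OF istopology_ptopology])

lemma topspace_ptopology: "topspace (ptopology X p) = X"
proof -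
  have "openin (ptopology X p) X"
    unfolding openin_ptopology
  proof (intro conjI ballI subset_refl)
    fix x
    have "pball X p x 1 \<subseteq> X" unfolding pball_def by (rule Collect_restrict)
    then show "\<exists>r>0. pball X p x r \<subseteq> X" by (intro exI[of _ 1]) simp
  qed
  moreover have "topspace (ptopology X p) \<subseteq> X"
    using openin_topspace openin_ptopology by (rule iffD1[THEN conjunct1, rotated])
  ultimately show ?thesis
    by (simp add: openin_subset subset_antisym)
qed

text \<open>
  Since \<open>p x x \<le> p (s n) x\<close> on \<open>X\<close> by the axioms, the guard in the following definition is always
  satisfied by a sequence in \<open>X\<close>; it is what makes the convergence ``from right''.
\<close>

definition r_convergent_right_to ::
    "('a \<Rightarrow> 'a \<Rightarrow> real) \<Rightarrow> real \<Rightarrow> (nat \<Rightarrow> 'a) \<Rightarrow> 'a \<Rightarrow> bool" where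
  "r_convergent_right_to p r s x \<longleftrightarrow>
     (\<forall>\<epsilon>>0. \<exists>k. \<forall>n\<ge>k. p (s n) x \<ge> p x x \<longrightarrow> \<bar>p (s n) x - p x x\<bar> < r + \<epsilon>)"

definition r_convergent_right ::
    "'a set \<Rightarrow> ('a \<Rightarrow> 'a \<Rightarrow> real) \<Rightarrow> real \<Rightarrow> (nat \<Rightarrow> 'a) \<Rightarrow> bool" where
  "r_convergent_right X p r s \<longleftrightarrow> (\<exists>x\<in>X. r_convergent_right_to p r s x)"

definition R_LIM ::
    "'a set \<Rightarrow> ('a \<Rightarrow> 'a \<Rightarrow> real) \<Rightarrow> real \<Rightarrow> (nat \<Rightarrow> 'a) \<Rightarrow> 'a set" where
  "R_LIM X p r s = {x \<in> X. r_convergent_right_to p r s x}"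

end

theory Submission
  imports Defs
begin

text \<open>
  For \<open>y\<close> in the ball of radius \<open>\<delta>\<close> about \<open>x\<close>, the triangle inequality (p4) through \<open>y\<close> gives
  \<open>p z y - p y y > p z x - p x x - \<delta>\<close> for every \<open>z\<close>. If \<open>x\<close> is not an \<open>r\<close>-limit because
  \<open>p (s n) x - p x x \<ge> r + \<epsilon>\<close> for infinitely many \<open>n\<close>, then no point of the ball of radius
  \<open>\<epsilon> / 2\<close> about \<open>x\<close> is an \<open>r\<close>-limit.
\<close>

context partial_metric_space
begin

lemma pball_excess:
  assumes "x \<in> X" "z \<in> X" "y \<in> pball X p x d"
  shows "p z x - p x x < p z y - p y y + d"
  using assms p3[of x y] p4[of z x y] by (auto simp: pball_def)

text \<open>By (p1) and (p3), \<open>p (s n) x - p x x\<close> is nonnegative, so the guard holds at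
  every \<open>n\<close> and the difference equals its absolute value.\<close>

lemma r_convergent_right_to_iff:
  assumes "\<And>n. s n \<in> X" "x \<in> X"
  shows "r_convergent_right_to p r s x \<longleftrightarrow> (\<forall>e>0. \<exists>k. \<forall>n\<ge>k. p (s n) x - p x x < r + e)"
proof -
  have "p x x \<le> p (s n) x" for n
    using assms p1[of x "s n"] p3[of x "s n"] by simp
  then show ?thesis
    by (simp add: r_convergent_right_to_def)
qed

lemma closedin_R_LIM:
  assumes s: "\<And>n. s n \<in> X"
  shows "closedin (ptopology X p) (R_LIM X p r s)"
  unfolding closedin_def topspace_ptopology openin_ptopology
proof (intro conjI ballI)
  fix x assume "x \<in> X - R_LIM X p r s"
  then have x: "x \<in> X" and "\<not> r_convergent_right_to p r s x"
    by (auto simp: R_LIM_def)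
  then obtain e where e: "e > 0" "\<And>k. \<exists>n\<ge>k. r + e \<le> p (s n) x - p x x"
    by (auto simp: r_convergent_right_to_iff[OF s] not_less)
  have "y \<in> X - R_LIM X p r s" if y: "y \<in> pball X p x (e / 2)" for y
  proof -
    have yX: "y \<in> X" using y by (simp add: pball_def)
    \<comment> \<open>Passing from \<open>x\<close> to \<open>y\<close> costs less than
      \<open>e / 2\<close> of the excess \<open>r + e\<close>; the other half is the tolerance at
      which convergence to \<open>y\<close> fails.\<close>
    have "\<exists>n\<ge>k. \<not> p (s n) y - p y y < r + e / 2" for k
    proof -
      obtain n where "n \<ge> k" "r + e \<le> p (s n) x - p x x" using e(2) by blast
      then show ?thesis
        using pball_excess[OF x s y, of n] by (intro exI[of _ n]) simp
    qed
    then have "\<not> r_convergent_right_to p r s y"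
      using e(1) half_gt_zero unfolding r_convergent_right_to_iff[OF s yX] by blast
    then show ?thesis using yX by (simp add: R_LIM_def)
  qed
  then show "\<exists>d>0. pball X p x d \<subseteq> X - R_LIM X p r s"
    using e(1) by (intro exI[of _ "e / 2"]) auto
\<comment> \<open>What remains is that \<open>R_LIM X p r s\<close> and its complement lie in
  \<open>X\<close>.\<close>
qed (auto simp: R_LIM_def)

end

theorem corollary3p1:
  fixes X :: "'a set" and p :: "'a \<Rightarrow> 'a \<Rightarrow> real" and r :: real and s :: "nat \<Rightarrow> 'a"
  assumes "partial_metric_space X p"
    and "r \<ge> 0"
    and "\<And>n. s n \<in> X"
    and "r_convergent_right X p r s"
  shows "closedin (ptopology X p) (R_LIM X p r s)"
  using assms(1,3) by (rule partial_metric_space.closedin_R_LIM)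

end
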